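(* There exist a cop-win graph $G$ of finite corner rank and a Lower Way strategy for the cop on $G$ that is not a Catching strategy.
   Context: All graphs are finite, nonempty and reflexive (every vertex adjacent to itself). For distinct vertices $v,w$ of a graph $H$: $w$ corners $v$ in $H$ if every vertex of $H$ adjacent to $v$ is adjacent to $w$; $w$ strictly corners $v$ in $H$ if moreover some vertex of $H$ adjacent to $w$ is not adjacent to $v$; a strict corner of $H$ is a vertex strictly cornered in $H$ by another vertex. We also say $c$ corners $x$ in $H$ when $c=x$. Corner ranking: $G_1=G$, $k=1$. If $G_k$ is a clique, its vertices get rank $k$; stop. Else if $G_k$ has no strict corners, its vertices get rank $\infty$; stop. Else the set $X$ of strict corners of $G_k$ gets rank $k$, $G_{k+1}=G_k-X$, increase $k$, repeat. $\mathrm{cr}(v)$ is the rank of $v$, $\mathrm{cr}(G)$ the maximum rank. For finite corner rank $\alpha\ge2$: $G$ is $1$-cop-win ($r=1$) if some (equivalently every) vertex of rank $\alpha$ is adjacent to all vertices of $G_{\alpha-1}$, otherwise $0$-cop-win ($r=0$). Projections: $f_k(\{u\})=\{u\}$ if $\mathrm{cr}(u)>k$, otherwise the set of vertices of $G_{k+1}$ that strictly corner $u$ in $G_k$; $f_k(S)=\bigcup_{u\in S}f_k(\{u\})$; $F_1$ the identity, $F_k=f_{k-1}\circ\cdots\circ f_1$, $F_k(v)=F_k(\{v\})$. Game: cop places, robber places, then alternate moves with the cop first; a move is staying or moving to an adjacent vertex; the cop wins when both share a vertex. With the cop at $c$ and robber at $x$: $x$ is $0$-cornered if $c=x$; for $k\ge1$,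 $x$ is $k$-cornered by $c$ if some $x'\in F_k(x)$ is cornered by $c$ in the subgraph induced by $V(G_k)\cup\{c\}$; the cop has $k$-caught the robber if $c\in F_k(x)$. A standard initial placement is a vertex adjacent to every vertex of $G_{\alpha-r}$. Lower Way strategy: standard initial placement and, for every $t\ge1$, after $t$ cop moves the cop $k$-corners the robber for some $k\le\alpha-r-t$. Catching strategy: standard initial placement and, for every $t\ge1$, after $t$ cop moves the cop has $k$-caught the robber for some $k\le\alpha-r-t+1$. *)

theory Defs
  imports Main "HOL-Library.Extended_Nat"
begin

text \<open>
  A graph is given by its vertex set \<open>V\<close> and its adjacency relation \<open>E\<close>. Induced subgraphs are given
  by their vertex set \<open>W\<close> only, with the same \<open>E\<close>.
\<close>

definition graph :: "'a set \<Rightarrow> 'a rel \<Rightarrow> bool" where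
  "graph V E \<longleftrightarrow> finite V \<and> V \<noteq> {} \<and> E \<subseteq> V \<times> V \<and> refl_on V E \<and> sym E"

definition clique :: "'a rel \<Rightarrow> 'a set \<Rightarrow> bool" where
  "clique E W \<longleftrightarrow> (\<forall>u\<in>W. \<forall>v\<in>W. (u, v) \<in> E)"

text \<open>\<open>w = v\<close> is allowed here: a vertex corners itself.\<close>

definition corners :: "'a rel \<Rightarrow> 'a set \<Rightarrow> 'a \<Rightarrow> 'a \<Rightarrow> bool" where
  "corners E W w v \<longleftrightarrow> w \<in> W \<and> v \<in> W \<and> (\<forall>u\<in>W. (v, u) \<in> E \<longrightarrow> (w, u) \<in> E)"

definition strictly_corners :: "'a rel \<Rightarrow> 'a set \<Rightarrow> 'a \<Rightarrow> 'a \<Rightarrow> bool" where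
  "strictly_corners E W w v \<longleftrightarrow>
     w \<noteq> v \<and> corners E W w v \<and> (\<exists>u\<in>W. (w, u) \<in> E \<and> (v, u) \<notin> E)"

definition strict_corners :: "'a rel \<Rightarrow> 'a set \<Rightarrow> 'a set" where
  "strict_corners E W = {v \<in> W. \<exists>w\<in>W. strictly_corners E W w v}"


section \<open>Corner ranking\<close>

definition peeled :: "'a rel \<Rightarrow> 'a set \<Rightarrow> 'a set" where
  "peeled E W = (if clique E W then W else strict_corners E W)"

text \<open>
  \<open>layer V E k\<close> is \<open>G\<^sub>k\<close>, for \<open>k \<ge> 1\<close>. The sequence is continued after the procedure has stopped:
  with the empty set if it stopped at a clique, and as a constant if it stopped for lack of
  strict corners. In the latter case nothing is peeled, so the remaining vertices get rank \<open>\<infinity>\<close>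
  below.
\<close>

fun layer :: "'a set \<Rightarrow> 'a rel \<Rightarrow> nat \<Rightarrow> 'a set" where
  "layer V E 0 = V"
| "layer V E (Suc 0) = V"
| "layer V E (Suc (Suc k)) = layer V E (Suc k) - peeled E (layer V E (Suc k))"

text \<open>The set of candidates has at most one element; the infimum of the empty set is \<open>\<infinity>\<close>.\<close>

definition vertex_rank :: "'a set \<Rightarrow> 'a rel \<Rightarrow> 'a \<Rightarrow> enat" where
  "vertex_rank V E v = Inf {enat k | k. 1 \<le> k \<and> v \<in> peeled E (layer V E k)}"

definition corner_rank :: "'a set \<Rightarrow> 'a rel \<Rightarrow> enat" where
  "corner_rank V E = Max (vertex_rank V E ` V)"

text \<open>The number \<open>r\<close>, meaningful for finite corner rank at least 2.\<close>

definition top_type :: "'a set \<Rightarrow> 'a rel \<Rightarrow> nat" where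
  "top_type V E =
     (if \<exists>v\<in>V. vertex_rank V E v = corner_rank V E \<and>
               (\<forall>u\<in>layer V E (the_enat (corner_rank V E) - 1). (v, u) \<in> E)
      then 1 else 0)"


section \<open>Projections\<close>

definition proj :: "'a set \<Rightarrow> 'a rel \<Rightarrow> nat \<Rightarrow> 'a set \<Rightarrow> 'a set" where
  "proj V E k S =
     (\<Union>u\<in>S. if vertex_rank V E u > enat k then {u}
            else {w \<in> layer V E (Suc k). strictly_corners E (layer V E k) w u})"

text \<open>\<open>iproj V E k\<close> is \<open>F\<^sub>k\<close>, for \<open>k \<ge> 1\<close>.\<close>

fun iproj :: "'a set \<Rightarrow> 'a rel \<Rightarrow> nat \<Rightarrow> 'a set \<Rightarrow> 'a set" where
  "iproj V E 0 S = S"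
| "iproj V E (Suc 0) S = S"
| "iproj V E (Suc (Suc k)) S = proj V E (Suc k) (iproj V E (Suc k) S)"

text \<open>The cop is at \<open>c\<close>, the robber at \<open>x\<close>.\<close>

definition k_cornered :: "'a set \<Rightarrow> 'a rel \<Rightarrow> nat \<Rightarrow> 'a \<Rightarrow> 'a \<Rightarrow> bool" where
  "k_cornered V E k c x \<longleftrightarrow>
     (if k = 0 then c = x
      else \<exists>x'\<in>iproj V E k {x}. corners E (layer V E k \<union> {c}) c x')"

definition k_caught :: "'a set \<Rightarrow> 'a rel \<Rightarrow> nat \<Rightarrow> 'a \<Rightarrow> 'a \<Rightarrow> bool" where
  "k_caught V E k c x \<longleftrightarrow> 1 \<le> k \<and> c \<in> iproj V E k {x}"


section \<open>The game\<close>

text \<open>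
  A cop strategy consists of the initial vertex and a function that maps the robber's positions so
  far (placement first) to the cop's next vertex. The cop's own earlier positions are determined
  by these, so this is a general history-dependent strategy.

  A play is given by the robber's trajectory: \<open>x 0\<close> is the placement and \<open>x t\<close> the position after
  \<open>t\<close> robber moves. Any finite sequence of legal robber moves extends to such a trajectory since
  the robber may stay; what happens after the cop has won is ignored.
\<close>

type_synonym 'a strategy = "'a \<times> ('a list \<Rightarrow> 'a)"

definition robber_play :: "'a set \<Rightarrow> 'a rel \<Rightarrow> (nat \<Rightarrow> 'a) \<Rightarrow> bool" where
  "robber_play V E x \<longleftrightarrow> x 0 \<in> V \<and> (\<forall>t. (x t, x (Suc t)) \<in> E)"

text \<open>The cop's position after \<open>t\<close> cop moves.\<close>

fun cop_pos :: "'a strategy \<Rightarrow> (nat \<Rightarrow> 'a) \<Rightarrow> nat \<Rightarrow> 'a" where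
  "cop_pos s x 0 = fst s"
| "cop_pos s x (Suc t) = snd s (map x [0..<Suc t])"

text \<open>
  The cop has not won before making move number \<open>t + 1\<close>: the two players shared a vertex neither
  after the placements or a robber move, nor after a cop move.
\<close>

definition ongoing :: "'a strategy \<Rightarrow> (nat \<Rightarrow> 'a) \<Rightarrow> nat \<Rightarrow> bool" where
  "ongoing s x t \<longleftrightarrow> (\<forall>i\<le>t. cop_pos s x i \<noteq> x i) \<and> (\<forall>i<t. cop_pos s x (Suc i) \<noteq> x i)"

definition cop_strategy :: "'a set \<Rightarrow> 'a rel \<Rightarrow> 'a strategy \<Rightarrow> bool" where
  "cop_strategy V E s \<longleftrightarrow>
     fst s \<in> V \<and>
     (\<forall>x t. robber_play V E x \<and> ongoing s x t \<longrightarrow> (cop_pos s x t, cop_pos s x (Suc t)) \<in> E)"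

definition cop_win :: "'a set \<Rightarrow> 'a rel \<Rightarrow> bool" where
  "cop_win V E \<longleftrightarrow>
     (\<exists>s. cop_strategy V E s \<and> (\<forall>x. robber_play V E x \<longrightarrow> (\<exists>t. \<not> ongoing s x t)))"

definition standard_placement :: "'a set \<Rightarrow> 'a rel \<Rightarrow> 'a \<Rightarrow> bool" where
  "standard_placement V E c \<longleftrightarrow>
     c \<in> V \<and>
     (\<forall>u\<in>layer V E (the_enat (corner_rank V E) - top_type V E). (c, u) \<in> E)"

text \<open>
  The conditions are imposed on each cop move that is actually made; since \<open>ongoing s x t\<close> refers
  to move number \<open>Suc t\<close>, that move meets the robber at \<open>x t\<close>. The bounds
  \<open>k \<le> \<alpha> - r - t\<close> and \<open>k \<le> \<alpha> - r - t + 1\<close>, with integer subtraction, are written additively,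
  with \<open>Suc t\<close> for \<open>t\<close>.
\<close>

definition lower_way :: "'a set \<Rightarrow> 'a rel \<Rightarrow> 'a strategy \<Rightarrow> bool" where
  "lower_way V E s \<longleftrightarrow>
     cop_strategy V E s \<and> standard_placement V E (fst s) \<and>
     (\<forall>x t. robber_play V E x \<and> ongoing s x t \<longrightarrow>
        (\<exists>k. k + top_type V E + Suc t \<le> the_enat (corner_rank V E) \<and>
             k_cornered V E k (cop_pos s x (Suc t)) (x t)))"

definition catching :: "'a set \<Rightarrow> 'a rel \<Rightarrow> 'a strategy \<Rightarrow> bool" where
  "catching V E s \<longleftrightarrow>
     cop_strategy V E s \<and> standard_placement V E (fst s) \<and>
     (\<forall>x t. robber_play V E x \<and> ongoing s x t \<longrightarrow>
        (\<exists>k. k + top_type V E + Suc t \<le> the_enat (corner_rank V E) + 1 \<and>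
             k_caught V E k (cop_pos s x (Suc t)) (x t)))"

end

theory Submission
  imports Defs
begin

text \<open>
  The graph is the path \<open>0 - 1 - 2 - 3\<close> together with a vertex \<open>4\<close> adjacent to \<open>1\<close>, \<open>2\<close>, \<open>3\<close> and a
  vertex \<open>5\<close> adjacent to \<open>1\<close>, \<open>2\<close>. Its corner rank is \<open>2\<close>, with top layer \<open>{1, 2}\<close>, and \<open>r = 0\<close>. The
  cop starts at \<open>1\<close>, so the robber survives the first cop move only if he is placed at \<open>3\<close>. Then the
  cop moves to \<open>4\<close>, which corners \<open>3\<close>, and captures the robber one move later. But \<open>4\<close> is itself
  strictly cornered by \<open>2\<close> (the vertex \<open>5\<close> distinguishes them), so it has rank \<open>1\<close> and does not lie
  in \<open>F\<^sub>2(3) = {2}\<close>. A Catching strategy would have to move to \<open>2\<close>.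
\<close>

definition exV :: "nat set" where
  "exV = {0, 1, 2, 3, 4, 5}"

definition exE :: "nat rel" where
  "exE = {0} \<times> {0, 1} \<union> {1} \<times> {0, 1, 2, 4, 5} \<union> {2} \<times> {1, 2, 3, 4, 5} \<union>
         {3} \<times> {2, 3, 4} \<union> {4} \<times> {1, 2, 3, 4} \<union> {5} \<times> {1, 2, 5}"

text \<open>\<open>last h\<close> is the robber's current vertex. Moving there is not legal for
  every history, but legality is demanded only while the game is ongoing. The history
  \<open>[3]\<close> can occur only at the first cop move.\<close>

definition ex_strategy :: "nat strategy" where
  "ex_strategy = (1, \<lambda>h. if h = [3] then 4 else last h)"

lemma graph_ex: "graph exV exE"
proof -
  have "sym exE"
  proof (rule symI)
    fix u v
    assume "(u, v) \<in> exE"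
    then show "(v, u) \<in> exE"
      unfolding exE_def by (elim UnE SigmaE) auto
  qed
  moreover have "exE \<subseteq> exV \<times> exV" "refl_on exV exE"
    unfolding exV_def exE_def refl_on_def by simp_all
  ultimately show ?thesis
    unfolding graph_def by (simp add: exV_def)
qed

lemma not_clique_exV: "\<not> clique exE exV"
proof -
  have "0 \<in> exV" "2 \<in> exV" "(0, 2) \<notin> exE"
    by (simp_all add: exV_def exE_def)
  then show ?thesis
    by (auto simp: clique_def)
qed

text \<open>\<open>1\<close> strictly corners \<open>0\<close>, and \<open>2\<close> strictly
  corners \<open>3\<close>, \<open>4\<close> and \<open>5\<close>. Only \<open>1\<close> is adjacent
  to both \<open>0\<close> and \<open>2\<close>, and only \<open>2\<close> to both \<open>3\<close>
  and \<open>5\<close>, so no other vertex corners \<open>1\<close> or \<open>2\<close>.\<close>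

lemma strict_corners_exV: "strict_corners exE exV = {0, 3, 4, 5}"
proof -
  have "(\<exists>w\<in>exV. strictly_corners exE exV w v) \<longleftrightarrow> v \<in> {0, 3, 4, 5}" if v: "v \<in> exV" for v
  proof -
    consider "v = 0" | "v = 1" | "v = 2" | "v = 3" | "v = 4" | "v = 5"
      using v unfolding exV_def by blast
    then show ?thesis
      by cases (simp_all add: strictly_corners_def corners_def exV_def exE_def)
  qed
  then show ?thesis
    by (auto simp: strict_corners_def) (auto simp: exV_def)
qed

lemma layer_ex_2: "layer exV exE 2 = {1, 2}"
proof -
  have "layer exV exE 2 = exV - {0, 3, 4, 5}"
    using not_clique_exV strict_corners_exV by (simp add: numeral_2_eq_2 peeled_def)
  also have "\<dots> = {1, 2}"
    unfolding exV_def by (simp add: insert_Diff_if)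
  finally show ?thesis .
qed

lemma clique_ex_top: "clique exE {1, 2}"
  by (simp add: clique_def exE_def)

lemma layer_ex_ge_3: "layer exV exE (Suc (Suc (Suc n))) = {}"
proof (induction n)
  case 0
  have "layer exV exE (Suc (Suc 0)) = {1, 2}"
    using layer_ex_2 by (simp only: numeral_2_eq_2)
  then show ?case
    using clique_ex_top by (simp only: layer.simps(3)[of _ _ "Suc 0"] peeled_def if_True Diff_cancel)
qed (simp only: layer.simps(3) empty_Diff)

text \<open>All \<open>k\<close> are covered because the rank is an infimum over all layers,
  including those after the procedure has stopped.\<close>

lemma peeled_ex:
  assumes "1 \<le> k"
  shows "peeled exE (layer exV exE k) = (if k = 1 then {0, 3, 4, 5} else if k = 2 then {1, 2} else {})"
proof -
  consider "k = 1" | "k = 2" | n where "k = Suc (Suc (Suc n))"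
  proof -
    have "k = 1 \<or> k = 2 \<or> k = Suc (Suc (Suc (k - 3)))"
      using assms by linarith
    then show thesis
      using that by blast
  qed
  then show ?thesis
  proof cases
    case 1
    then show ?thesis
      using not_clique_exV strict_corners_exV by (simp add: peeled_def)
  next
    case 2
    then show ?thesis
      using clique_ex_top by (simp add: layer_ex_2 peeled_def)
  next
    case 3
    have "peeled exE (layer exV exE k) = {}"
      unfolding 3 layer_ex_ge_3 by (simp add: peeled_def clique_def)
    moreover have "k \<noteq> 1" "k \<noteq> 2"
      unfolding 3 by simp_all
    ultimately show ?thesis
      by simp
  qed
qed

lemma vertex_rank_ex:
  assumes "v \<in> exV"
  shows "vertex_rank exV exE v = (if v = 1 \<or> v = 2 then 2 else 1)"
proof -
  have mem: "v \<in> {0, 1, 2, 3, 4, 5}"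
    using assms by (simp only: exV_def)
  \<comment> \<open>Each vertex is peeled exactly once, so the infimum is taken over a
    singleton.\<close>
  have "{enat k | k. 1 \<le> k \<and> v \<in> peeled exE (layer exV exE k)} = {if v = 1 \<or> v = 2 then enat 2 else enat 1}"
    using mem peeled_ex[of 1] by (auto simp: peeled_ex split: if_splits)
  then show ?thesis
    by (simp add: vertex_rank_def numeral_eq_enat one_enat_def)
qed

lemma corner_rank_ex: "corner_rank exV exE = 2"
proof -
  have "vertex_rank exV exE ` exV = (\<lambda>v. if v = 1 \<or> v = 2 then 2 else 1) ` exV"
    by (rule image_cong[OF refl vertex_rank_ex])
  also have "\<dots> = {1, 2}"
    unfolding exV_def by simp
  finally show ?thesis
    unfolding corner_rank_def by simp
qed

lemma the_corner_rank_ex: "the_enat (corner_rank exV exE) = 2"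
  by (simp add: corner_rank_ex numeral_eq_enat)

text \<open>The layer below the top is the whole graph, in which \<open>1\<close> misses
  \<open>3\<close> and \<open>2\<close> misses \<open>0\<close>.\<close>

lemma top_type_ex: "top_type exV exE = 0"
proof -
  have "3 \<in> exV" "(1, 3) \<notin> exE" "0 \<in> exV" "(2, 0) \<notin> exE"
    by (simp_all add: exV_def exE_def)
  then have "\<exists>u\<in>exV. (v, u) \<notin> exE" if "v = 1 \<or> v = 2" for v
    using that by blast
  moreover have "v = 1 \<or> v = 2" if "v \<in> exV" "vertex_rank exV exE v = 2" for v
    using that by (simp add: vertex_rank_ex split: if_splits)
  moreover have "layer exV exE (2 - 1) = exV"
    by simp
  ultimately show ?thesis
    unfolding top_type_def the_corner_rank_ex unfolding corner_rank_ex by (metis (full_types))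
qed

lemma standard_placement_ex: "standard_placement exV exE (fst ex_strategy)"
proof -
  have "1 \<in> exV" "\<forall>u\<in>{1, 2}. (1, u) \<in> exE"
    by (auto simp: exV_def exE_def)
  then show ?thesis
    by (simp add: standard_placement_def the_corner_rank_ex top_type_ex layer_ex_2 ex_strategy_def)
qed

text \<open>The history before cop move \<open>Suc t\<close> has \<open>Suc t\<close> entries, so it
  equals \<open>[3]\<close> only for \<open>t = 0\<close>. These equations hide the history lists
  from the rest of the proof.\<close>

lemma cop_pos_ex:
  "cop_pos ex_strategy x 0 = 1"
  "cop_pos ex_strategy x (Suc t) = (if t = 0 \<and> x 0 = 3 then 4 else x t)"
  by (auto simp: ex_strategy_def)

declare cop_pos.simps [simp del]

text \<open>Every cop move except the one answering placement \<open>3\<close> lands on the robber,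
  so at most two moves are made, and a second one only after that placement.\<close>

lemma ongoing_ex:
  assumes "robber_play exV exE x" "ongoing ex_strategy x t"
  shows "t = 0 \<and> x 0 \<in> exV \<and> x 0 \<noteq> 1 \<or> t = 1 \<and> x 0 = 3 \<and> x 1 \<in> {2, 3, 4}"
proof -
  have x0: "x 0 \<in> exV" "(x 0, x 1) \<in> exE"
    using assms(1) by (auto simp: robber_play_def)
  have moves: "cop_pos ex_strategy x (Suc i) \<noteq> x i" if "i < t" for i
    using assms(2) that by (auto simp: ongoing_def)
  consider "t = 0" | "t = 1" | "t \<ge> 2" by linarith
  then show ?thesis
  proof cases
    case 1
    then show ?thesis
      using assms(2) x0 by (auto simp: ongoing_def cop_pos_ex)
  next
    case 2
    then have "x 0 = 3"
      using moves[of 0] by (auto simp: cop_pos_ex split: if_splits)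
    with 2 x0(2) show ?thesis
      by (auto simp: exE_def)
  next
    case 3
    then show ?thesis
      using moves[of 1] by (auto simp: cop_pos_ex)
  qed
qed

lemma cop_strategy_ex: "cop_strategy exV exE ex_strategy"
proof -
  have "(cop_pos ex_strategy x t, cop_pos ex_strategy x (Suc t)) \<in> exE"
    if "robber_play exV exE x" "ongoing ex_strategy x t" for x t
    using ongoing_ex[OF that]
  proof
    assume "t = 0 \<and> x 0 \<in> exV \<and> x 0 \<noteq> 1"
    then show ?thesis
      by (auto simp: cop_pos_ex exV_def exE_def)
  next
    assume "t = 1 \<and> x 0 = 3 \<and> x 1 \<in> {2, 3, 4}"
    then show ?thesis
      using cop_pos_ex(2)[of x 0] cop_pos_ex(2)[of x 1] by (auto simp: exE_def)
  qed
  moreover have "fst ex_strategy \<in> exV"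
    by (simp add: ex_strategy_def exV_def)
  ultimately show ?thesis
    by (auto simp: cop_strategy_def)
qed

lemma cop_win_ex: "cop_win exV exE"
proof -
  have "\<not> ongoing ex_strategy x 2" if "robber_play exV exE x" for x
    using ongoing_ex[OF that, of 2] by auto
  with cop_strategy_ex show ?thesis
    unfolding cop_win_def by blast
qed

text \<open>With \<alpha> - r = 2, the first move may use \<open>k = 1\<close>, where
  \<open>iproj\<close> is the identity and the layer is the whole graph; every other move captures
  and gives \<open>k = 0\<close>.\<close>

lemma lower_way_ex: "lower_way exV exE ex_strategy"
proof -
  have "\<exists>k. k + Suc t \<le> 2 \<and> k_cornered exV exE k (cop_pos ex_strategy x (Suc t)) (x t)"
    if "robber_play exV exE x" "ongoing ex_strategy x t" for x t
  proof (cases "t = 0 \<and> x 0 = 3")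
    case True
    have "k_cornered exV exE 1 4 3"
      by (auto simp: k_cornered_def corners_def exV_def exE_def)
    with True show ?thesis
      by (intro exI[of _ 1]) (simp add: cop_pos_ex)
  next
    case False
    then have "k_cornered exV exE 0 (cop_pos ex_strategy x (Suc t)) (x t)"
      by (auto simp: k_cornered_def cop_pos_ex)
    with ongoing_ex[OF that] show ?thesis
      by (intro exI[of _ 0]) auto
  qed
  then show ?thesis
    unfolding lower_way_def the_corner_rank_ex top_type_ex
    using cop_strategy_ex standard_placement_ex by simp
qed

text \<open>\<open>k = 0\<close> is excluded by definition, \<open>k = 1\<close> projects
  \<open>3\<close> to itself, and \<open>k = 2\<close> projects it into the top layer, which omits
  \<open>4\<close>.\<close>

lemma not_k_caught_ex:
  assumes "k \<le> 2"
  shows "\<not> k_caught exV exE k 4 3"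
proof -
  have "iproj exV exE 2 {3} \<subseteq> {1, 2}"
    using layer_ex_2 vertex_rank_ex[of 3]
    by (auto simp: numeral_2_eq_2 proj_def exV_def one_enat_def)
  moreover have "k = 0 \<or> k = 1 \<or> k = 2"
    using assms by auto
  ultimately show ?thesis
    by (auto simp: k_caught_def)
qed

lemma not_catching_ex: "\<not> catching exV exE ex_strategy"
proof
  assume "catching exV exE ex_strategy"
  then have caught: "\<exists>k. k + 0 + Suc t \<le> 2 + 1 \<and> k_caught exV exE k (cop_pos ex_strategy x (Suc t)) (x t)"
    if "robber_play exV exE x" "ongoing ex_strategy x t" for x t
    using that by (simp only: catching_def top_type_ex the_corner_rank_ex)
  \<comment> \<open>The robber who stays at \<open>3\<close> violates the condition at the first cop
    move, where the bound is \<open>k \<le> 2\<close>.\<close>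
  have "robber_play exV exE (\<lambda>_. 3)"
    by (simp add: robber_play_def exV_def exE_def)
  moreover have "ongoing ex_strategy (\<lambda>_. 3) 0"
    by (simp add: ongoing_def cop_pos_ex)
  ultimately obtain k where "k \<le> 2" "k_caught exV exE k 4 3"
    using caught[of "\<lambda>_. 3" 0] by (auto simp: cop_pos_ex)
  then show False
    using not_k_caught_ex by simp
qed

theorem theorem7p1:
  shows "\<exists>(V :: nat set) E s.
           graph V E \<and> cop_win V E \<and> corner_rank V E \<noteq> \<infinity> \<and> 2 \<le> corner_rank V E \<and>
           lower_way V E s \<and> \<not> catching V E s"
  using graph_ex cop_win_ex lower_way_ex not_catching_ex corner_rank_ex
  by (intro exI[of _ exV] exI[of _ exE] exI[of _ ex_strategy]) simp

end
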